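(* Let $H[t]=H_1[t]+H_2[t]$ (with $H_i[t]\in V_i$, $t>0$) be the Lie integral, equivalently the logarithm of the development, of a horizontal path in a $2$-step graded nilpotent Lie algebra $V_1\oplus V_2$, and suppose that the abelian asymptotic limit $\mu=\lim_{t\to\infty}H_1[t]/t$ exists. Then the Benardete–Mitchell invariant $\operatorname{Alim}(H[t])$ is given by $$\operatorname{Alim}(H[t])=\mu+\lim_{t\to\infty}\left(\frac{H_2[t]}{t}+\frac12[H_1[t]-t\mu,\mu]\right),$$ whenever the displayed limit exists. In the Heisenberg Lie algebra with basis $X,Y,Z$, $[X,Y]=Z$ central, with $H_1[t]=F(t)X+G(t)Y$, $H_2[t]=\frac12A(t)Z$, $\mu=\bar fX+\bar gY$, $F(t)=\bar ft+\widetilde F(t)$ and $G(t)=\bar gt+\widetilde G(t)$, the central coefficient $\Lambda^{(1)}_{2,\mathrm{BM}}\big|_Z$, i.e. the $Z$-coefficient of $\operatorname{Alim}(H[t])$, is $$\Lambda^{(1)}_{2,\mathrm{BM}}\big|_Z=\frac12\lim_{t\to\infty}\frac{A_{\mathrm{BM}}(t)}{t},\qquad A_{\mathrm{BM}}(t)=A(t)+\bar g\,t\,\widetilde F(t)-\bar f\,t\,\widetilde G(t).$$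
   Context: $V_1\oplus V_2$ is a finite-dimensional real Lie algebra with $[V_1,V_1]\subseteq V_2$ and $V_2$ central. The Benardete–Mitchell asymptotic limit is defined, for $\mu=\lim_{t\to\infty}H_1[t]/t$, by $$\operatorname{Alim}(H[t])=\lim_{t\to\infty}\left(\frac{H[t]}{t}+\frac12[H[t],\mu]\right)$$ whenever this limit exists. Lie integral in the $2$-step case: for a continuous path $\ell:[0,\infty)\to V_1$ of bounded variation on compact intervals, $H_1[t]=\ell(t)-\ell(0)$ and $H_2[t]=\frac12\int_{0<u_2<u_1<t}[d\ell(u_1),d\ell(u_2)]$. In the Heisenberg case with $\ell(t)=\int_0^t(f(s)X+g(s)Y)\,ds$: $F(t)=\int_0^tf(s)\,ds$, $G(t)=\int_0^tg(s)\,ds$ and $$A(t)=\int_{0<u_2<u_1<t}\bigl(f(u_1)g(u_2)-g(u_1)f(u_2)\bigr)\,du_2\,du_1 .$$ *)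

theory Defs
  imports "HOL-Analysis.Analysis"
begin

section \<open>Finite-dimensional real Lie algebras\<close>

text \<open>The Euclidean structure of the carrier type only provides finite dimension and the
  canonical topology; no compatibility between the inner product and the bracket is assumed.\<close>

locale real_lie_algebra =
  fixes br :: "'a::euclidean_space \<Rightarrow> 'a \<Rightarrow> 'a"
  assumes bilinear_br: "bilinear br"
    and br_self: "br x x = 0"
    and jacobi: "br x (br y z) + br y (br z x) + br z (br x y) = 0"

locale two_step_graded_lie_algebra = real_lie_algebra br
  for br :: "'a::euclidean_space \<Rightarrow> 'a \<Rightarrow> 'a" +
  fixes V1 V2 :: "'a set"
  assumes subspace_V1: "subspace V1"
    and subspace_V2: "subspace V2"
    and V1_Int_V2: "V1 \<inter> V2 = {0}"
    and V1_plus_V2: "\<exists>v\<in>V1. \<exists>w\<in>V2. x = v + w"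
    and br_V1_V1: "v \<in> V1 \<Longrightarrow> w \<in> V1 \<Longrightarrow> br v w \<in> V2"
    and V2_central: "z \<in> V2 \<Longrightarrow> br z x = 0"

locale heisenberg_lie_algebra = real_lie_algebra br
  for br :: "'a::euclidean_space \<Rightarrow> 'a \<Rightarrow> 'a" +
  fixes X Y Z :: 'a
  assumes distinct_XYZ: "distinct [X, Y, Z]"
    and independent_XYZ: "independent {X, Y, Z}"
    and span_XYZ: "span {X, Y, Z} = UNIV"
    and br_X_Y: "br X Y = Z"
    and Z_central: "br Z x = 0"

text \<open>The projection onto \<open>V1\<close> along \<open>V2\<close>.\<close>

definition layer1 :: "'a::real_vector set \<Rightarrow> 'a set \<Rightarrow> 'a \<Rightarrow> 'a" where
  "layer1 V1 V2 x = (THE v. v \<in> V1 \<and> x - v \<in> V2)"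


section \<open>Stieltjes integrals\<close>

text \<open>The integral of \<open>B (dg u) (f u)\<close> over the compact interval \<open>S\<close>, in the gauge formulation the
  library uses for \<^const>\<open>has_integral\<close>, with the value 0 if the integral does not exist (as for
  \<^const>\<open>integral\<close>). If \<open>B\<close> is bilinear, \<open>f\<close> continuous and \<open>g\<close> of bounded variation, the
  integral exists and is the Riemann-Stieltjes integral.\<close>

definition has_stieltjes_integral ::
  "('a::real_normed_vector \<Rightarrow> 'b \<Rightarrow> 'c::real_normed_vector)
    \<Rightarrow> (real \<Rightarrow> 'a) \<Rightarrow> (real \<Rightarrow> 'b) \<Rightarrow> 'c \<Rightarrow> real set \<Rightarrow> bool" where
  "has_stieltjes_integral B g f I S \<longleftrightarrow>
     ((\<lambda>p. \<Sum>(u, k)\<in>p. B (g (Sup k) - g (Inf k)) (f u)) \<longlongrightarrow> I) (division_filter S)"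

definition stieltjes_integral ::
  "real set \<Rightarrow> ('a::real_normed_vector \<Rightarrow> 'b \<Rightarrow> 'c::real_normed_vector)
    \<Rightarrow> (real \<Rightarrow> 'a) \<Rightarrow> (real \<Rightarrow> 'b) \<Rightarrow> 'c" where
  "stieltjes_integral S B g f =
     (if \<exists>I. has_stieltjes_integral B g f I S
      then THE I. has_stieltjes_integral B g f I S else 0)"

definition bounded_variation_on :: "real \<Rightarrow> real \<Rightarrow> (real \<Rightarrow> 'a::real_normed_vector) \<Rightarrow> bool" where
  "bounded_variation_on a b g \<longleftrightarrow>
     (\<exists>C. \<forall>d. d division_of {a..b} \<longrightarrow> (\<Sum>k\<in>d. norm (g (Sup k) - g (Inf k))) \<le> C)"


section \<open>Horizontal paths and their Lie integral\<close>

definition horizontal_path :: "'a::real_normed_vector set \<Rightarrow> (real \<Rightarrow> 'a) \<Rightarrow> bool" where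
  "horizontal_path V1 l \<longleftrightarrow>
     (\<forall>t\<ge>0. l t \<in> V1) \<and> continuous_on {0..} l \<and>
     (\<forall>a b. 0 \<le> a \<longrightarrow> a \<le> b \<longrightarrow> bounded_variation_on a b l)"

definition lie_integral1 :: "(real \<Rightarrow> 'a::real_normed_vector) \<Rightarrow> real \<Rightarrow> 'a" where
  "lie_integral1 l t = l t - l 0"

text \<open>The integral over \<open>0 < u2 < u1 < t\<close> is written as an iterated integral; the inner one
  integrates the constant 1 against \<open>dl(u2)\<close>.\<close>

definition lie_integral2 ::
  "('a::real_normed_vector \<Rightarrow> 'a \<Rightarrow> 'a) \<Rightarrow> (real \<Rightarrow> 'a) \<Rightarrow> real \<Rightarrow> 'a" where
  "lie_integral2 br l t =
     (1/2) *\<^sub>R stieltjes_integral {0..t} br l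
       (\<lambda>u1. stieltjes_integral {0..u1} (\<lambda>v (c::real). c *\<^sub>R v) l (\<lambda>u2. 1))"

definition lie_integral ::
  "('a::real_normed_vector \<Rightarrow> 'a \<Rightarrow> 'a) \<Rightarrow> (real \<Rightarrow> 'a) \<Rightarrow> real \<Rightarrow> 'a" where
  "lie_integral br l t = lie_integral1 l t + lie_integral2 br l t"


section \<open>The Benardete--Mitchell asymptotic limit\<close>

definition has_Alim ::
  "('a::real_normed_vector \<Rightarrow> 'a \<Rightarrow> 'a) \<Rightarrow> 'a set \<Rightarrow> 'a set \<Rightarrow> (real \<Rightarrow> 'a) \<Rightarrow> 'a \<Rightarrow> bool" where
  "has_Alim br V1 V2 H a \<longleftrightarrow>
     (\<exists>\<mu>. ((\<lambda>t. (1/t) *\<^sub>R layer1 V1 V2 (H t)) \<longlongrightarrow> \<mu>) at_top \<and>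
          ((\<lambda>t. (1/t) *\<^sub>R H t + (1/2) *\<^sub>R br (H t) \<mu>) \<longlongrightarrow> a) at_top)"

definition Alim ::
  "('a::real_normed_vector \<Rightarrow> 'a \<Rightarrow> 'a) \<Rightarrow> 'a set \<Rightarrow> 'a set \<Rightarrow> (real \<Rightarrow> 'a) \<Rightarrow> 'a" where
  "Alim br V1 V2 H = (THE a. has_Alim br V1 V2 H a)"


section \<open>Paths in the Heisenberg algebra given by their velocity\<close>

definition heis_path ::
  "'a::euclidean_space \<Rightarrow> 'a \<Rightarrow> (real \<Rightarrow> real) \<Rightarrow> (real \<Rightarrow> real) \<Rightarrow> real \<Rightarrow> 'a" where
  "heis_path X Y f g t = integral {0..t} (\<lambda>s. f s *\<^sub>R X + g s *\<^sub>R Y)"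

definition primitive :: "(real \<Rightarrow> real) \<Rightarrow> real \<Rightarrow> real" where
  "primitive f t = integral {0..t} f"

definition heis_area :: "(real \<Rightarrow> real) \<Rightarrow> (real \<Rightarrow> real) \<Rightarrow> real \<Rightarrow> real" where
  "heis_area f g t =
     integral {0<..<t} (\<lambda>u1. integral {0<..<u1} (\<lambda>u2. f u1 * g u2 - g u1 * f u2))"

text \<open>The bracketed terms are the deviations of the primitives from their asymptotic linear growth.\<close>

definition heis_area_BM ::
  "(real \<Rightarrow> real) \<Rightarrow> (real \<Rightarrow> real) \<Rightarrow> real \<Rightarrow> real \<Rightarrow> real \<Rightarrow> real" where
  "heis_area_BM f g fbar gbar t =
     heis_area f g t + gbar * t * (primitive f t - fbar * t) - fbar * t * (primitive g t - gbar * t)"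

end

theory Submission
  imports Defs
begin

text \<open>On \<open>V2\<close> the bracket vanishes and \<open>[\<mu>, \<mu>] = 0\<close>, so the Benardete--Mitchell expression is
  \<open>H\<^sub>1/t\<close> plus the displayed \<open>V2\<close>-valued one. The second layer of the Lie integral lies
  in \<open>V2\<close> whether or not the Stieltjes integral exists, since its approximating sums do and \<open>V2\<close> is
  closed. For a Heisenberg path with integrable velocity the Stieltjes integral is identified with
  the integral of the bracket of velocity and position by Henstock's lemma.\<close>

section \<open>Stieltjes integrals\<close>

text \<open>The division filter of a compact interval is proper, so limits along it are unique. This
  makes the \<open>THE\<close> in \<open>stieltjes_integral\<close> well determined.\<close>

lemma has_stieltjes_integral_unique:
  assumes "has_stieltjes_integral B g f I {a..b}" "has_stieltjes_integral B g f J {a..b}"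
  shows "I = J"
  using tendsto_unique[OF division_filter_not_empty[of a b]] assms
  unfolding has_stieltjes_integral_def by simp

lemma stieltjes_integral_eqI:
  assumes "has_stieltjes_integral B g f I {a..b}"
  shows "stieltjes_integral {a..b} B g f = I"
proof -
  have "(THE I. has_stieltjes_integral B g f I {a..b}) = I"
    using assms by (rule the_equality) (rule has_stieltjes_integral_unique[OF _ assms])
  with assms show ?thesis unfolding stieltjes_integral_def by metis
qed

text \<open>Every approximating sum telescopes to \<open>l b - l a\<close>. This evaluates the inner
  integral of \<open>lie_integral2\<close>.\<close>

lemma stieltjes_integral_one:
  assumes "a \<le> b"
  shows "stieltjes_integral {a..b} (\<lambda>v (c::real). c *\<^sub>R v) l (\<lambda>_. 1) = l b - l a"
proof (rule stieltjes_integral_eqI)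
  have "\<forall>\<^sub>F p in division_filter {a..b}. (\<Sum>(u, k)\<in>p. 1 *\<^sub>R (l (Sup k) - l (Inf k))) = l b - l a"
    using eventually_division_filter_tagged_division
    by (rule eventually_mono) (simp add: additive_tagged_division_1[OF assms])
  then show "has_stieltjes_integral (\<lambda>v c. c *\<^sub>R v) l (\<lambda>_. 1) (l b - l a) {a..b}"
    unfolding has_stieltjes_integral_def by (simp add: tendsto_eventually)
qed

text \<open>The approximating sums lie in the closed subspace \<open>W\<close>, hence so does their
  limit; if there is no limit, the default value 0 lies in \<open>W\<close> as well.\<close>

lemma stieltjes_integral_mem:
  assumes W: "closed W" "subspace W"
    and mem: "\<And>u v x. u \<in> {a..b} \<Longrightarrow> v \<in> {a..b} \<Longrightarrow> x \<in> {a..b} \<Longrightarrow> B (g v - g u) (f x) \<in> W"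
  shows "stieltjes_integral {a..b} B g f \<in> W"
proof (cases "\<exists>I. has_stieltjes_integral B g f I {a..b}")
  case True
  then obtain I where I: "has_stieltjes_integral B g f I {a..b}" by blast
  have "(\<Sum>(x, k)\<in>p. B (g (Sup k) - g (Inf k)) (f x)) \<in> W" if p: "p tagged_division_of {a..b}" for p
  proof (rule subspace_sum[OF W(2)], clarsimp)
    fix x k assume xk: "(x, k) \<in> p"
    note d = tagged_division_ofD(2,3,4)[OF p xk]
    then obtain c e where k: "k = {c..e}" by (metis box_real(2))
    \<comment> \<open>The tag lies in \<open>k\<close>, so \<open>k\<close> is nonempty and
      \<open>Inf k\<close>, \<open>Sup k\<close> are its endpoints.\<close>
    with d have "c \<le> e" by auto
    with d k show "B (g (Sup k) - g (Inf k)) (f x) \<in> W"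
      by (intro mem) auto
  qed
  then have "\<forall>\<^sub>F p in division_filter {a..b}. (\<Sum>(x, k)\<in>p. B (g (Sup k) - g (Inf k)) (f x)) \<in> W"
    using eventually_division_filter_tagged_division by (rule eventually_mono[rotated])
  then have "I \<in> W"
    using I division_filter_not_empty[of a b]
    unfolding has_stieltjes_integral_def
    by (intro Lim_in_closed_set[OF W(1), of _ "division_filter {a..b}"]) auto
  with I show ?thesis by (simp add: stieltjes_integral_eqI)
next
  case False
  then show ?thesis by (auto simp: stieltjes_integral_def subspace_0[OF W(2)])
qed

text \<open>A continuous function on a compact interval is bounded and measurable, so pairing it
  with an absolutely integrable one preserves absolute integrability. The arguments of
  \<open>B\<close> are swapped in the proof because the rule applied there takes the bounded factor
  first.\<close>

lemma absolutely_integrable_bilinear_continuous: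
  fixes B :: "'a::euclidean_space \<Rightarrow> 'b::euclidean_space \<Rightarrow> 'c::euclidean_space" and a b :: real
  assumes B: "bilinear B"
    and h: "h absolutely_integrable_on {a..b}"
    and w: "continuous_on {a..b} w"
  shows "(\<lambda>u. B (h u) (w u)) absolutely_integrable_on {a..b}"
proof (rule absolutely_integrable_bounded_measurable_product[of "\<lambda>x y. B y x", OF _ _ _ _ h])
  show "bounded (w ` {a..b})"
    by (intro compact_imp_bounded compact_continuous_image[OF w]) simp
qed (use B w in \<open>auto simp: bilinear_def continuous_imp_measurable_on_sets_lebesgue\<close>)

text \<open>The Stieltjes sum \<open>?S\<close> is the Riemann sum \<open>?R\<close> of
  \<open>B (h u) (w u)\<close> minus an error \<open>?E\<close>, in which each tagged interval
  contributes its deviation of \<open>h\<close> paired with \<open>w\<close>. Henstock's lemma makes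
  these deviations small in total, and \<open>w\<close> is bounded.\<close>

lemma has_stieltjes_integral_indefinite_integral:
  fixes B :: "'a::euclidean_space \<Rightarrow> 'b::euclidean_space \<Rightarrow> 'c::euclidean_space"
  assumes B: "bilinear B"
    and h: "h absolutely_integrable_on {a..b}"
    and w: "continuous_on {a..b} w"
  shows "has_stieltjes_integral B (\<lambda>u. integral {a..u} h) w (integral {a..b} (\<lambda>u. B (h u) (w u))) {a..b}"
proof -
  interpret bounded_bilinear B
    using B by (simp add: bilinear_conv_bounded_bilinear)
  obtain K where K: "K > 0" "\<And>x y. norm (B x y) \<le> norm x * norm y * K"
    using pos_bounded by blast
  have "bounded (w ` {a..b})"
    by (intro compact_imp_bounded compact_continuous_image[OF w]) simp
  then obtain M where M: "M > 0" "\<And>u. u \<in> {a..b} \<Longrightarrow> norm (w u) \<le> M"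
    unfolding bounded_pos by auto
  have hi: "h integrable_on {a..b}"
    using h by (rule set_lebesgue_integral_eq_integral)
  have Bi: "(\<lambda>u. B (h u) (w u)) integrable_on cbox a b"
    using absolutely_integrable_bilinear_continuous[OF B h w]
    by (simp add: set_lebesgue_integral_eq_integral)
  let ?R = "\<lambda>p. \<Sum>(u, k)\<in>p. measure lborel k *\<^sub>R B (h u) (w u)"
  let ?E = "\<lambda>p. \<Sum>(u, k)\<in>p. B (measure lborel k *\<^sub>R h u - integral k h) (w u)"
  let ?S = "\<lambda>p. \<Sum>(u, k)\<in>p. B (integral {a..Sup k} h - integral {a..Inf k} h) (w u)"
  have R: "(?R \<longlongrightarrow> integral {a..b} (\<lambda>u. B (h u) (w u))) (division_filter {a..b})"
    using integrable_integral[OF Bi] unfolding has_integral_cbox by simp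
  have E: "(?E \<longlongrightarrow> 0) (division_filter {a..b})"
  proof (rule tendstoI)
    fix e :: real assume e: "e > 0"
    \<comment> \<open>\<open>M\<close> bounds \<open>w\<close> and \<open>K\<close> is a bound for
      \<open>B\<close>, so each error term is at most \<open>M * K\<close> times its Henstock
      deviation.\<close>
    have "e / (M * K) > 0" using e K M by simp
    then obtain \<gamma> where \<gamma>: "gauge \<gamma>"
      "\<And>p. p tagged_partial_division_of {a..b} \<Longrightarrow> \<gamma> fine p \<Longrightarrow>
         (\<Sum>(x, k)\<in>p. norm (measure lborel k *\<^sub>R h x - integral k h)) < e / (M * K)"
      using Henstock_lemma[of h a b "e / (M * K)"] hi unfolding box_real by blast
    have "norm (?E p) < e" if p: "p tagged_division_of {a..b}" "\<gamma> fine p" for p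
    proof -
      have "norm (?E p) \<le> (\<Sum>(x, k)\<in>p. norm (measure lborel k *\<^sub>R h x - integral k h) * (M * K))"
      proof (rule sum_norm_le, clarsimp)
        fix x k assume "(x, k) \<in> p"
        then have "x \<in> {a..b}" using tag_in_interval p(1) by metis
        then have "norm (measure lborel k *\<^sub>R h x - integral k h) * norm (w x) * K
            \<le> norm (measure lborel k *\<^sub>R h x - integral k h) * M * K"
          using M K by (intro mult_right_mono mult_left_mono) auto
        then show "norm (B (measure lborel k *\<^sub>R h x - integral k h) (w x))
            \<le> norm (measure lborel k *\<^sub>R h x - integral k h) * (M * K)"
          using K(2)[of "measure lborel k *\<^sub>R h x - integral k h" "w x"] by (simp add: mult.assoc)
      qed
      also have "\<dots> = (\<Sum>(x, k)\<in>p. norm (measure lborel k *\<^sub>R h x - integral k h)) * (M * K)"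
        by (simp add: sum_distrib_right split_def)
      also have "\<dots> < e / (M * K) * (M * K)"
        using \<gamma>(2)[of p] p K M by (intro mult_strict_right_mono) (auto simp: tagged_division_of_def)
      finally show ?thesis using K M by simp
    qed
    then show "\<forall>\<^sub>F p in division_filter {a..b}. dist (?E p) 0 < e"
      unfolding eventually_division_filter using \<gamma>(1) by auto
  qed
  \<comment> \<open>The increment of the indefinite integral over \<open>k\<close> is
    \<open>integral k h\<close>, so the identity holds term by term.\<close>
  have S: "?R p - ?E p = ?S p" if p: "p tagged_division_of {a..b}" for p
    unfolding sum_subtractf[symmetric]
  proof (rule sum.cong[OF refl], clarsimp)
    fix x k assume xk: "(x, k) \<in> p"
    note d = tagged_division_ofD(2,3,4)[OF p xk]
    then obtain c e where k: "k = {c..e}" by (metis box_real(2))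
    with d have ce: "a \<le> c" "c \<le> e" "e \<le> b" by auto
    have "integral {a..c} h + integral {c..e} h = integral {a..e} h"
      using ce by (intro Henstock_Kurzweil_Integration.integral_combine
        integrable_on_subinterval[OF hi]) auto
    then have "integral {a..Sup k} h - integral {a..Inf k} h = integral k h"
      using k ce by (simp add: algebra_simps)
    then show "measure lborel k *\<^sub>R B (h x) (w x) - B (measure lborel k *\<^sub>R h x - integral k h) (w x)
       = B (integral {a..Sup k} h - integral {a..Inf k} h) (w x)"
      by (simp add: diff_left scaleR_left)
  qed
  have "(?S \<longlongrightarrow> integral {a..b} (\<lambda>u. B (h u) (w u)) - 0) (division_filter {a..b})"
    by (rule Lim_transform_eventually[OF tendsto_diff[OF R E]])
      (rule eventually_mono[OF eventually_division_filter_tagged_division S])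
  then show ?thesis by (simp add: has_stieltjes_integral_def)
qed

section \<open>Two-step graded algebras\<close>

text \<open>The inner integral equals \<open>l u - l 0\<close> at every tag \<open>u\<close>, and
  the sums see the integrand only at tags. Hence both outer integrals have the same possible limits,
  and the equality also covers the default value.\<close>

lemma lie_integral2_eq:
  assumes "0 \<le> t"
  shows "lie_integral2 br l t = (1/2) *\<^sub>R stieltjes_integral {0..t} br l (\<lambda>u. l u - l 0)"
proof -
  have "(\<Sum>(u, k)\<in>p. br (l (Sup k) - l (Inf k))
           (stieltjes_integral {0..u} (\<lambda>v (c::real). c *\<^sub>R v) l (\<lambda>_. 1)))
      = (\<Sum>(u, k)\<in>p. br (l (Sup k) - l (Inf k)) (l u - l 0))"
    if "p tagged_division_of {0..t}" for p
    by (rule sum.cong) (use that in \<open>auto simp: stieltjes_integral_one dest!: tag_in_interval\<close>)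
  then have "has_stieltjes_integral br l
      (\<lambda>u. stieltjes_integral {0..u} (\<lambda>v (c::real). c *\<^sub>R v) l (\<lambda>_. 1)) I {0..t}
    \<longleftrightarrow> has_stieltjes_integral br l (\<lambda>u. l u - l 0) I {0..t}" for I
    unfolding has_stieltjes_integral_def
    by (intro tendsto_cong eventually_mono[OF eventually_division_filter_tagged_division])
  then show ?thesis
    unfolding lie_integral2_def stieltjes_integral_def by presburger
qed

section \<open>Bracket rules in a real Lie algebra\<close>

context real_lie_algebra
begin

sublocale bounded_bilinear br
  using bilinear_br by (simp add: bilinear_conv_bounded_bilinear)

text \<open>Polarization of \<open>br_self\<close> at \<open>x + y\<close>.\<close>

lemma br_anticommute: "br y x = - br x y"
proof -
  have "br x y + br y x = 0"
    using br_self[of "x + y"] unfolding add_left add_right by (simp add: br_self add.commute)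
  then show ?thesis by (simp add: eq_neg_iff_add_eq_0 add.commute)
qed

end

section \<open>The asymptotic limit in a two-step graded algebra\<close>

context two_step_graded_lie_algebra
begin

text \<open>Two candidates for the first layer differ by an element of
  \<open>V1 \<inter> V2\<close>, which is trivial.\<close>

lemma layer1_add:
  assumes "v \<in> V1" "w \<in> V2"
  shows "layer1 V1 V2 (v + w) = v"
  unfolding layer1_def
proof (rule the_equality)
  fix u assume u: "u \<in> V1 \<and> v + w - u \<in> V2"
  then have "v - u \<in> V1" "(v + w - u) - w \<in> V2"
    using assms subspace_diff[OF subspace_V1] subspace_diff[OF subspace_V2] by blast+
  then have "v - u \<in> V1 \<inter> V2" by (simp add: algebra_simps)
  then show "u = v" by (simp add: V1_Int_V2)
qed (use assms in auto)

text \<open>Increments of \<open>l\<close> lie in \<open>V1\<close>, their brackets in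
  \<open>V2\<close>, and a subspace of a finite-dimensional space is closed.\<close>

lemma lie_integral2_mem_V2:
  assumes "\<And>u. u \<ge> 0 \<Longrightarrow> l u \<in> V1" "0 \<le> t"
  shows "lie_integral2 br l t \<in> V2"
  unfolding lie_integral2_eq[OF \<open>0 \<le> t\<close>]
  by (intro subspace_scale stieltjes_integral_mem closed_subspace br_V1_V1
      subspace_diff subspace_V1 subspace_V2) (use assms in auto)

text \<open>Centrality of \<open>V2\<close> and [\<mu>, \<mu>] = 0 turn the bracket with H into the
  bracket with H1 - t \<mu>. What remains is H1/t, with limit \<mu>, plus the displayed expression,
  so either both limits exist or neither does. An equivalence is stated because the Heisenberg case
  also needs the converse.\<close>

lemma has_Alim_lie_integral_iff:
  assumes l: "\<And>u. u \<ge> 0 \<Longrightarrow> l u \<in> V1"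
    and mu: "((\<lambda>t. (1/t) *\<^sub>R lie_integral1 l t) \<longlongrightarrow> \<mu>) at_top"
  shows "has_Alim br V1 V2 (lie_integral br l) (\<mu> + L) \<longleftrightarrow>
    ((\<lambda>t. (1/t) *\<^sub>R lie_integral2 br l t
        + (1/2) *\<^sub>R br (lie_integral1 l t - t *\<^sub>R \<mu>) \<mu>) \<longlongrightarrow> L) at_top"
    (is "_ \<longleftrightarrow> (?D \<longlongrightarrow> L) at_top")
proof -
  let ?H = "lie_integral br l"
  have lay: "\<forall>\<^sub>F t in at_top. (1/t) *\<^sub>R layer1 V1 V2 (?H t) = (1/t) *\<^sub>R lie_integral1 l t"
    using eventually_ge_at_top[of 0]
  proof eventually_elim
    case (elim t)
    then show ?case
      unfolding lie_integral_def
      by (subst layer1_add)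
        (auto simp: lie_integral1_def intro!: lie_integral2_mem_V2 subspace_diff subspace_V1 l)
  qed
  \<comment> \<open>Uniqueness of limits collapses the existential quantifier in
    \<open>has_Alim\<close> to the given \<mu>.\<close>
  have lay_lim: "((\<lambda>t. (1/t) *\<^sub>R layer1 V1 V2 (?H t)) \<longlongrightarrow> \<nu>) at_top \<longleftrightarrow> \<nu> = \<mu>" for \<nu>
    unfolding tendsto_cong[OF lay] using mu tendsto_unique[OF trivial_limit_at_top_linorder _ mu]
    by blast
  have cong: "\<forall>\<^sub>F t in at_top. (1/t) *\<^sub>R ?H t + (1/2) *\<^sub>R br (?H t) \<mu>
      = (1/t) *\<^sub>R lie_integral1 l t + ?D t"
    using eventually_ge_at_top[of 0]
  proof eventually_elim
    case (elim t)
    then have "br (lie_integral2 br l t) \<mu> = 0"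
      by (intro V2_central lie_integral2_mem_V2 l)
    then show ?case
      by (simp add: lie_integral_def add_left diff_left scaleR_left br_self algebra_simps)
  qed
  have "has_Alim br V1 V2 ?H (\<mu> + L) \<longleftrightarrow>
      ((\<lambda>t. (1/t) *\<^sub>R lie_integral1 l t + ?D t) \<longlongrightarrow> \<mu> + L) at_top"
    by (simp only: has_Alim_def lay_lim simp_thms tendsto_cong[OF cong])
  also have "\<dots> \<longleftrightarrow> (?D \<longlongrightarrow> L) at_top"
  proof
    assume "((\<lambda>t. (1/t) *\<^sub>R lie_integral1 l t + ?D t) \<longlongrightarrow> \<mu> + L) at_top"
    from tendsto_diff[OF this mu] show "(?D \<longlongrightarrow> L) at_top"
      by (simp only: add_diff_cancel_left')
  qed (rule tendsto_add[OF mu])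
  finally show ?thesis .
qed

lemma Alim_lie_integral_eq:
  assumes l: "\<And>u. u \<ge> 0 \<Longrightarrow> l u \<in> V1"
    and mu: "((\<lambda>t. (1/t) *\<^sub>R lie_integral1 l t) \<longlongrightarrow> \<mu>) at_top"
    and L: "((\<lambda>t. (1/t) *\<^sub>R lie_integral2 br l t
        + (1/2) *\<^sub>R br (lie_integral1 l t - t *\<^sub>R \<mu>) \<mu>) \<longlongrightarrow> L) at_top"
  shows "Alim br V1 V2 (lie_integral br l) = \<mu> + L"
  unfolding Alim_def
proof (rule the_equality)
  show "has_Alim br V1 V2 (lie_integral br l) (\<mu> + L)"
    using L by (simp add: has_Alim_lie_integral_iff[OF l mu])
next
  fix a assume "has_Alim br V1 V2 (lie_integral br l) a"
  \<comment> \<open>Any candidate \<open>a\<close> is brought into the form required by the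
    equivalence, which makes \<open>a - \<mu>\<close> a limit of the expression converging to
    \<open>L\<close>.\<close>
  then have "has_Alim br V1 V2 (lie_integral br l) (\<mu> + (a - \<mu>))" by simp
  then have "a - \<mu> = L"
    using has_Alim_lie_integral_iff[OF l mu] tendsto_unique[OF trivial_limit_at_top_linorder _ L]
    by blast
  then show "a = \<mu> + L" by (simp add: algebra_simps)
qed

end

section \<open>The Heisenberg algebra\<close>

lemma heis_path_eq:
  assumes "f integrable_on {0..t}" "g integrable_on {0..t}"
  shows "heis_path X Y f g t = primitive f t *\<^sub>R X + primitive g t *\<^sub>R Y"
  unfolding heis_path_def primitive_def
  by (intro integral_unique has_integral_add has_integral_scaleR_left integrable_integral assms)

lemma lie_integral1_heis_path:
  assumes "f integrable_on {0..t}" "g integrable_on {0..t}"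
  shows "lie_integral1 (heis_path X Y f g) t = primitive f t *\<^sub>R X + primitive g t *\<^sub>R Y"
  using heis_path_eq[OF assms, of X Y] by (simp add: lie_integral1_def heis_path_def)

text \<open>For fixed \<open>u1\<close> the inner integral is linear in \<open>f\<close> and
  \<open>g\<close> and yields their primitives; passing from open to closed intervals does not
  change the integrals. The resulting integrand is the \<open>Z\<close>-coefficient of the bracket
  of velocity and position.\<close>

lemma heis_area_eq:
  assumes "\<And>u. 0 \<le> u \<Longrightarrow> f integrable_on {0..u}" "\<And>u. 0 \<le> u \<Longrightarrow> g integrable_on {0..u}"
  shows "heis_area f g t = integral {0..t} (\<lambda>u. f u * primitive g u - g u * primitive f u)"
proof -
  have "integral {0..u1} (\<lambda>u2. f u1 * g u2 - g u1 * f u2)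
      = f u1 * primitive g u1 - g u1 * primitive f u1" if "0 \<le> u1" for u1
    unfolding primitive_def using assms[OF that]
    by (subst integral_diff) (auto intro: integrable_on_mult_right)
  then show ?thesis
    unfolding heis_area_def integral_open_interval_real by (intro integral_cong) auto
qed

section \<open>The Heisenberg algebra in coordinates and its grading\<close>

context heisenberg_lie_algebra
begin

lemma Z_nonzero: "Z \<noteq> 0"
  using independent_XYZ dependent_zero[of "{X, Y, Z}"] by auto

lemma br_XY:
  "br (a *\<^sub>R X + b *\<^sub>R Y) (c *\<^sub>R X + d *\<^sub>R Y) = (a * d - b * c) *\<^sub>R Z"
proof -
  have "br Y X = - Z" using br_anticommute[of Y X] by (simp add: br_X_Y)
  then show ?thesis
    by (simp add: add_left add_right scaleR_left scaleR_right br_self br_X_Y scaleR_diff_left mult.commute)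
qed

text \<open>Makes the general equivalence available here: independence of the basis separates the
  layers, spanning gives their sum, and \<open>br_XY\<close> puts brackets of the first layer into
  the second.\<close>

lemma two_step_graded: "two_step_graded_lie_algebra br (span {X, Y}) (span {Z})"
proof
  show "span {X, Y} \<inter> span {Z} = {0}"
  proof -
    have "Z \<notin> span {X, Y}"
    proof -
      have "{X, Y, Z} - {Z} = {X, Y}" using distinct_XYZ by auto
      then show ?thesis using independent_XYZ unfolding dependent_def by auto
    qed
    \<comment> \<open>Otherwise scaling by \<open>1/c\<close> would put \<open>Z\<close> itself into
      \<open>span {X, Y}\<close>.\<close>
    then have "c = 0" if "c *\<^sub>R Z \<in> span {X, Y}" for c
      using that span_scale[of "c *\<^sub>R Z" "{X, Y}" "1/c"] by (cases "c = 0") auto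
    then show ?thesis by (auto simp: span_singleton span_zero)
  qed
  show "\<exists>v\<in>span {X, Y}. \<exists>w\<in>span {Z}. x = v + w" for x
  proof -
    have "x \<in> span ({X, Y} \<union> {Z})" using span_XYZ by (simp add: insert_commute)
    then show ?thesis unfolding span_Un by blast
  qed
  show "br v w \<in> span {Z}" if "v \<in> span {X, Y}" "w \<in> span {X, Y}" for v w
  proof -
    have "\<exists>a b. u = a *\<^sub>R X + b *\<^sub>R Y" if u: "u \<in> span {X, Y}" for u
    proof -
      obtain a where "u - a *\<^sub>R X \<in> span {Y}"
        using u unfolding span_insert[of X] by blast
      then obtain b where "u - a *\<^sub>R X = b *\<^sub>R Y"
        unfolding span_singleton by blast
      then have "u = a *\<^sub>R X + b *\<^sub>R Y" by (simp add: diff_eq_eq add.commute)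
      then show ?thesis by blast
    qed
    with that obtain a b c d where "v = a *\<^sub>R X + b *\<^sub>R Y" "w = c *\<^sub>R X + d *\<^sub>R Y"
      by metis
    then show ?thesis by (simp add: br_XY span_base span_scale)
  qed
  show "br z x = 0" if "z \<in> span {Z}" for z x
    using that by (auto simp: span_singleton scaleR_left Z_central)
qed (auto simp: subspace_span)

text \<open>The coordinate functional of a basis is linear; it is 1 at \<open>Z\<close> and 0 at the
  other two basis vectors.\<close>

lemma representation_Z: "representation {X, Y, Z} (a *\<^sub>R X + b *\<^sub>R Y + c *\<^sub>R Z) Z = c"
proof -
  interpret r: linear "\<lambda>v. representation {X, Y, Z} v Z"
    using linear_representation[OF independent_XYZ span_XYZ, of Z]
    by (simp add: linear_def real_scaleR_def[abs_def])
  have "X \<noteq> Z" "Y \<noteq> Z" using distinct_XYZ by auto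
  then show ?thesis
    by (simp add: r.add r.scaleR representation_basis[OF independent_XYZ])
qed

text \<open>The path is the indefinite integral of its velocity, so the Stieltjes integral of the
  path against itself is the ordinary integral of the bracket of velocity and position, which
  \<open>br_XY\<close> and \<open>heis_area_eq\<close> identify.\<close>

lemma lie_integral2_heis_path:
  assumes f: "\<And>T. 0 \<le> T \<Longrightarrow> f absolutely_integrable_on {0..T}"
    and g: "\<And>T. 0 \<le> T \<Longrightarrow> g absolutely_integrable_on {0..T}"
    and t: "0 \<le> t"
  shows "lie_integral2 br (heis_path X Y f g) t = ((1/2) * heis_area f g t) *\<^sub>R Z"
proof -
  let ?l = "heis_path X Y f g" and ?h = "\<lambda>s. f s *\<^sub>R X + g s *\<^sub>R Y"
  have int: "\<And>u. 0 \<le> u \<Longrightarrow> f integrable_on {0..u}" "\<And>u. 0 \<le> u \<Longrightarrow> g integrable_on {0..u}"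
    using f g by (auto simp: set_lebesgue_integral_eq_integral)
  have h: "?h absolutely_integrable_on {0..t}"
    by (intro set_integral_add absolutely_integrable_scaleR_right f g t)
  have l0: "?l 0 = 0" by (simp add: heis_path_def)
  have "continuous_on {0..t} ?l"
    unfolding heis_path_def
    using h by (intro indefinite_integral_continuous_1) (rule set_lebesgue_integral_eq_integral)
  then have "has_stieltjes_integral br ?l ?l (integral {0..t} (\<lambda>u. br (?h u) (?l u))) {0..t}"
    using has_stieltjes_integral_indefinite_integral[OF bilinear_br h, of ?l]
    by (simp add: heis_path_def[abs_def])
  moreover have "integral {0..t} (\<lambda>u. br (?h u) (?l u))
      = integral {0..t} (\<lambda>u. (f u * primitive g u - g u * primitive f u) *\<^sub>R Z)"
    by (intro integral_cong) (simp add: heis_path_eq int br_XY)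
  moreover have "\<dots> = heis_area f g t *\<^sub>R Z"
  proof -
    \<comment> \<open>Continuity of the primitives makes the products integrable, so that
      \<open>Z\<close> can be taken out of the integral.\<close>
    have "continuous_on {0..t} (primitive f)" "continuous_on {0..t} (primitive g)"
      unfolding primitive_def[abs_def] by (intro indefinite_integral_continuous_1 int t)+
    then have "(\<lambda>u. f u * primitive g u) integrable_on {0..t}"
      "(\<lambda>u. g u * primitive f u) integrable_on {0..t}"
      using absolutely_integrable_bilinear_continuous[OF bilinear_times] f g t
      by (blast intro: set_lebesgue_integral_eq_integral(1))+
    then have "((\<lambda>u. f u * primitive g u - g u * primitive f u) has_integral heis_area f g t) {0..t}"
      using heis_area_eq[OF int, of t] by (simp add: integrable_integral integrable_diff)
    then show ?thesis by (intro integral_unique has_integral_scaleR_left)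
  qed
  ultimately show ?thesis
    by (simp add: lie_integral2_eq[OF t] l0 stieltjes_integral_eqI)
qed

text \<open>The \<open>V2\<close>-valued expression of the general equivalence is half of
  \<open>heis_area_BM\<close> over \<open>t\<close>, times \<open>Z\<close>. As \<open>Z\<close> is
  nonzero, it converges exactly when the scalar coefficient does.\<close>

lemma has_Alim_heis_path_iff:
  assumes f: "\<And>T. 0 \<le> T \<Longrightarrow> f absolutely_integrable_on {0..T}"
    and g: "\<And>T. 0 \<le> T \<Longrightarrow> g absolutely_integrable_on {0..T}"
    and mu: "((\<lambda>t. (1/t) *\<^sub>R lie_integral1 (heis_path X Y f g) t)
      \<longlongrightarrow> fbar *\<^sub>R X + gbar *\<^sub>R Y) at_top"
  shows "has_Alim br (span {X, Y}) (span {Z}) (lie_integral br (heis_path X Y f g)) a \<longleftrightarrow>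
    (\<exists>c. ((\<lambda>t. heis_area_BM f g fbar gbar t / t) \<longlongrightarrow> c) at_top \<and>
      a = fbar *\<^sub>R X + gbar *\<^sub>R Y + ((1/2) * c) *\<^sub>R Z)"
    (is "?Alim a \<longleftrightarrow> _")
proof -
  interpret two_step_graded_lie_algebra br "span {X, Y}" "span {Z}"
    by (rule two_step_graded)
  let ?l = "heis_path X Y f g" and ?\<mu> = "fbar *\<^sub>R X + gbar *\<^sub>R Y"
  let ?A = "\<lambda>t. heis_area_BM f g fbar gbar t / t"
  let ?D = "\<lambda>t. (1/t) *\<^sub>R lie_integral2 br ?l t + (1/2) *\<^sub>R br (lie_integral1 ?l t - t *\<^sub>R ?\<mu>) ?\<mu>"
  have int: "f integrable_on {0..u}" "g integrable_on {0..u}" if "0 \<le> u" for u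
    using f g that by (auto simp: set_lebesgue_integral_eq_integral)
  have l_mem: "?l u \<in> span {X, Y}" if "0 \<le> u" for u
    unfolding heis_path_eq[OF int[OF that]] by (intro span_add span_scale span_base) auto
  have D: "?D t = ((1/2) * ?A t) *\<^sub>R Z" if "t > 0" for t
  proof -
    have "lie_integral1 ?l t - t *\<^sub>R ?\<mu>
        = (primitive f t - fbar * t) *\<^sub>R X + (primitive g t - gbar * t) *\<^sub>R Y"
      using that int[of t] by (simp add: lie_integral1_heis_path algebra_simps)
    \<comment> \<open>This bracket is the source of the two correction terms in
      \<open>heis_area_BM\<close>; they carry a factor \<open>t\<close> there because the area is
      divided by \<open>t\<close> and the bracket is not.\<close>
    then have br: "br (lie_integral1 ?l t - t *\<^sub>R ?\<mu>) ?\<mu>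
        = ((primitive f t - fbar * t) * gbar - (primitive g t - gbar * t) * fbar) *\<^sub>R Z"
      by (simp only: br_XY)
    have "lie_integral2 br ?l t = ((1/2) * heis_area f g t) *\<^sub>R Z"
      using that by (intro lie_integral2_heis_path f g) auto
    then have "?D t = ((1/t) * ((1/2) * heis_area f g t) + (1/2) *
        ((primitive f t - fbar * t) * gbar - (primitive g t - gbar * t) * fbar)) *\<^sub>R Z"
      by (simp only: br scaleR_scaleR scaleR_add_left)
    also have "(1/t) * ((1/2) * heis_area f g t) + (1/2) *
        ((primitive f t - fbar * t) * gbar - (primitive g t - gbar * t) * fbar) = (1/2) * ?A t"
      using that by (simp add: heis_area_BM_def field_simps)
    finally show ?thesis .
  qed
  have D_lim: "(?D \<longlongrightarrow> L) at_top \<longleftrightarrow> ((\<lambda>t. ((1/2) * ?A t) *\<^sub>R Z) \<longlongrightarrow> L) at_top" for L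
    by (intro tendsto_cong eventually_mono[OF eventually_gt_at_top[of 0]] D)
  have "((\<lambda>t. ((1/2) * ?A t) *\<^sub>R Z) \<longlongrightarrow> L) at_top \<longleftrightarrow>
      (\<exists>c. (?A \<longlongrightarrow> c) at_top \<and> L = ((1/2) * c) *\<^sub>R Z)" for L
  proof
    assume lim: "((\<lambda>t. ((1/2) * ?A t) *\<^sub>R Z) \<longlongrightarrow> L) at_top"
    \<comment> \<open>The inner product with \<open>Z\<close> extracts the coefficient; the constant
      cancels \<open>1/2\<close> and \<open>Z \<bullet> Z\<close>.\<close>
    from tendsto_mult[OF tendsto_const[of "2 / (Z \<bullet> Z)"] tendsto_inner[OF this tendsto_const[of Z]]]
    have A: "(?A \<longlongrightarrow> 2 / (Z \<bullet> Z) * (L \<bullet> Z)) at_top"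
      using Z_nonzero by simp
    moreover have "((\<lambda>t. ((1/2) * ?A t) *\<^sub>R Z) \<longlongrightarrow> ((1/2) * (2 / (Z \<bullet> Z) * (L \<bullet> Z))) *\<^sub>R Z) at_top"
      by (intro tendsto_intros A)
    then have "L = ((1/2) * (2 / (Z \<bullet> Z) * (L \<bullet> Z))) *\<^sub>R Z"
      using lim by (intro tendsto_unique[OF trivial_limit_at_top_linorder])
    ultimately show "\<exists>c. (?A \<longlongrightarrow> c) at_top \<and> L = ((1/2) * c) *\<^sub>R Z" by blast
  next
    assume "\<exists>c. (?A \<longlongrightarrow> c) at_top \<and> L = ((1/2) * c) *\<^sub>R Z"
    then obtain c where c: "(?A \<longlongrightarrow> c) at_top" and L: "L = ((1/2) * c) *\<^sub>R Z" by blast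
    show "((\<lambda>t. ((1/2) * ?A t) *\<^sub>R Z) \<longlongrightarrow> L) at_top"
      unfolding L by (rule tendsto_scaleR[OF tendsto_mult[OF tendsto_const c] tendsto_const])
  qed
  then have shift: "?Alim (?\<mu> + L) \<longleftrightarrow> (\<exists>c. (?A \<longlongrightarrow> c) at_top \<and> L = ((1/2) * c) *\<^sub>R Z)" for L
    by (simp only: has_Alim_lie_integral_iff[OF l_mem mu] D_lim)
  \<comment> \<open>Splitting off \<mu> makes the equivalence applicable to an arbitrary
    \<open>a\<close>.\<close>
  have "?Alim a \<longleftrightarrow> ?Alim (?\<mu> + (a - ?\<mu>))" by simp
  also note shift
  finally show ?thesis
    by (simp only: diff_eq_eq add.commute)
qed

end

section \<open>Both formulas, read off from the two equivalences for \<open>has_Alim\<close>\<close>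

theorem proposition6p4:
  shows
    "(\<forall>(br :: 'a::euclidean_space \<Rightarrow> 'a \<Rightarrow> 'a) V1 V2 l \<mu>.
        two_step_graded_lie_algebra br V1 V2 \<and>
        horizontal_path V1 l \<and>
        ((\<lambda>t. (1/t) *\<^sub>R lie_integral1 l t) \<longlongrightarrow> \<mu>) at_top \<and>
        (\<exists>L. ((\<lambda>t. (1/t) *\<^sub>R lie_integral2 br l t
                 + (1/2) *\<^sub>R br (lie_integral1 l t - t *\<^sub>R \<mu>) \<mu>) \<longlongrightarrow> L) at_top)
        \<longrightarrow>
        (\<exists>a. has_Alim br V1 V2 (lie_integral br l) a) \<and>
        Alim br V1 V2 (lie_integral br l)
          = \<mu> + Lim at_top (\<lambda>t. (1/t) *\<^sub>R lie_integral2 br l t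
                 + (1/2) *\<^sub>R br (lie_integral1 l t - t *\<^sub>R \<mu>) \<mu>))
     \<and>
     (\<forall>(br :: 'b::euclidean_space \<Rightarrow> 'b \<Rightarrow> 'b) X Y Z f g fbar gbar l.
        heisenberg_lie_algebra br X Y Z \<and>
        (\<forall>T\<ge>0. f absolutely_integrable_on {0..T}) \<and>
        (\<forall>T\<ge>0. g absolutely_integrable_on {0..T}) \<and>
        l = heis_path X Y f g \<and>
        ((\<lambda>t. (1/t) *\<^sub>R lie_integral1 l t) \<longlongrightarrow> fbar *\<^sub>R X + gbar *\<^sub>R Y) at_top
        \<longrightarrow>
        (\<forall>t>0. lie_integral1 l t = primitive f t *\<^sub>R X + primitive g t *\<^sub>R Y) \<and>
        (\<forall>t>0. lie_integral2 br l t = ((1/2) * heis_area f g t) *\<^sub>R Z) \<and>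
        ((\<exists>a. has_Alim br (span {X, Y}) (span {Z}) (lie_integral br l) a) \<longleftrightarrow>
         (\<exists>c. ((\<lambda>t. heis_area_BM f g fbar gbar t / t) \<longlongrightarrow> c) at_top)) \<and>
        ((\<exists>c. ((\<lambda>t. heis_area_BM f g fbar gbar t / t) \<longlongrightarrow> c) at_top) \<longrightarrow>
         representation {X, Y, Z} (Alim br (span {X, Y}) (span {Z}) (lie_integral br l)) Z
           = (1/2) * Lim at_top (\<lambda>t. heis_area_BM f g fbar gbar t / t)))"
proof (intro conjI allI impI; elim conjE)
  fix br :: "'a \<Rightarrow> 'a \<Rightarrow> 'a" and V1 V2 l \<mu>
  let ?D = "\<lambda>t. (1/t) *\<^sub>R lie_integral2 br l t + (1/2) *\<^sub>R br (lie_integral1 l t - t *\<^sub>R \<mu>) \<mu>"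
  assume "two_step_graded_lie_algebra br V1 V2"
  then interpret two_step_graded_lie_algebra br V1 V2 .
  assume "horizontal_path V1 l"
  then have l: "l u \<in> V1" if "0 \<le> u" for u
    using that by (simp add: horizontal_path_def)
  assume mu: "((\<lambda>t. (1/t) *\<^sub>R lie_integral1 l t) \<longlongrightarrow> \<mu>) at_top"
    and "\<exists>L. (?D \<longlongrightarrow> L) at_top"
  then obtain L where L: "(?D \<longlongrightarrow> L) at_top" by blast
  show "\<exists>a. has_Alim br V1 V2 (lie_integral br l) a"
    using L has_Alim_lie_integral_iff[OF l mu] by blast
  show "Alim br V1 V2 (lie_integral br l) = \<mu> + Lim at_top ?D"
    by (simp only: Alim_lie_integral_eq[OF l mu L] tendsto_Lim[OF trivial_limit_at_top_linorder L])
next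
  fix br :: "'b \<Rightarrow> 'b \<Rightarrow> 'b" and X Y Z :: 'b and f g :: "real \<Rightarrow> real" and fbar gbar :: real and l
  assume "heisenberg_lie_algebra br X Y Z"
  then interpret heisenberg_lie_algebra br X Y Z .
  assume f: "\<forall>T\<ge>0. f absolutely_integrable_on {0..T}" and g: "\<forall>T\<ge>0. g absolutely_integrable_on {0..T}"
    and l: "l = heis_path X Y f g"
    and mu: "((\<lambda>t. (1/t) *\<^sub>R lie_integral1 l t) \<longlongrightarrow> fbar *\<^sub>R X + gbar *\<^sub>R Y) at_top"
  let ?A = "\<lambda>t. heis_area_BM f g fbar gbar t / t"
  let ?Alim = "has_Alim br (span {X, Y}) (span {Z}) (lie_integral br l)"
  \<comment> \<open>All values of the limit are described at once, which gives both the equivalence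
    of existence and the uniqueness behind \<open>Alim\<close>.\<close>
  have iff: "?Alim a \<longleftrightarrow>
      (\<exists>c. (?A \<longlongrightarrow> c) at_top \<and> a = fbar *\<^sub>R X + gbar *\<^sub>R Y + ((1/2) * c) *\<^sub>R Z)" for a
    unfolding l using f g mu[unfolded l] by (intro has_Alim_heis_path_iff) auto
  show "lie_integral1 l t = primitive f t *\<^sub>R X + primitive g t *\<^sub>R Y" if "t > 0" for t
    unfolding l using that f g
    by (intro lie_integral1_heis_path) (auto simp: set_lebesgue_integral_eq_integral)
  show "lie_integral2 br l t = ((1/2) * heis_area f g t) *\<^sub>R Z" if "t > 0" for t
    unfolding l using that f g by (intro lie_integral2_heis_path) auto
  show "(\<exists>a. ?Alim a) \<longleftrightarrow> (\<exists>c. (?A \<longlongrightarrow> c) at_top)"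
    unfolding iff by blast
  assume "\<exists>c. (?A \<longlongrightarrow> c) at_top"
  then obtain c where c: "(?A \<longlongrightarrow> c) at_top" by blast
  have "Alim br (span {X, Y}) (span {Z}) (lie_integral br l)
      = fbar *\<^sub>R X + gbar *\<^sub>R Y + ((1/2) * c) *\<^sub>R Z"
    unfolding Alim_def iff
    using c tendsto_unique[OF trivial_limit_at_top_linorder c] by (intro the_equality) blast+
  then show "representation {X, Y, Z} (Alim br (span {X, Y}) (span {Z}) (lie_integral br l)) Z
      = (1/2) * Lim at_top ?A"
    by (simp only: representation_Z tendsto_Lim[OF trivial_limit_at_top_linorder c])
qed

end
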